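(* Let $H$ be a contextuality scenario. If the graph $\mathrm{NO}(H)$ is perfect, then $\mathcal{C}(H)=\mathcal{CE}^1(H)$. However, $\mathcal{G}(H)$ can still be bigger: there exists a contextuality scenario $H$ with $\mathrm{NO}(H)$ perfect and $\mathcal{C}(H)=\mathcal{CE}^1(H)\subsetneq\mathcal{G}(H)$.
   Context: A contextuality scenario is a hypergraph $H$ with finite nonempty vertex set $V(H)$ and edge set $E(H)\subseteq 2^{V(H)}$ such that $\bigcup_{e\in E(H)}e=V(H)$. A probabilistic model on $H$ is a map $p:V(H)\to[0,1]$ with $\sum_{v\in e}p(v)=1$ for all $e\in E(H)$; $\mathcal{G}(H)$ is the set of these. A probabilistic model is deterministic if all its values lie in $\{0,1\}$; $\mathcal{C}(H)$ (classical models) is the set of convex combinations of deterministic probabilistic models. The non-orthogonality graph $\mathrm{NO}(H)$ is the simple graph on $V(H)$ in which $u,v$ are adjacent iff no edge $e\in E(H)$ satisfies $\{u,v\}\subseteq e$. $\mathcal{CE}^1(H)$ is the set of $p\in\mathcal{G}(H)$ with $\sum_{v\in I}p(v)\leq1$ for every independent set $I$ of $\mathrm{NO}(H)$. A graph is perfect if for each of its induced subgraphs the chromatic number equals the clique number. *)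

theory Defs
  imports Complex_Main "HOL-Library.FuncSet" "HOL-Library.Ramsey"
begin

text \<open>A simple graph is a hypergraph all of whose edges have exactly two elements. Cliques and
  independent sets are those of \<^theory>\<open>HOL-Library.Ramsey\<close>, which take an edge set only, so
  containment in the vertex set is stated separately.\<close>

record 'a hypergraph =
  verts :: "'a set"
  edges :: "'a set set"

definition induced_subgraph :: "'a hypergraph \<Rightarrow> 'a set \<Rightarrow> 'a hypergraph" where
  "induced_subgraph G S = \<lparr>verts = S, edges = {e \<in> edges G. e \<subseteq> S}\<rparr>"

definition proper_coloring :: "'a hypergraph \<Rightarrow> nat \<Rightarrow> ('a \<Rightarrow> nat) \<Rightarrow> bool" where
  "proper_coloring G k c \<longleftrightarrow>
     c ` verts G \<subseteq> {..<k} \<and>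
     (\<forall>u\<in>verts G. \<forall>v\<in>verts G. {u, v} \<in> edges G \<longrightarrow> c u \<noteq> c v)"

text \<open>The next two numbers are meaningful for finite simple graphs only; on an infinite or looped
  graph \<open>LEAST\<close> and \<open>Max\<close> may be unspecified.\<close>

definition chromatic_number :: "'a hypergraph \<Rightarrow> nat" where
  "chromatic_number G = (LEAST k. \<exists>c. proper_coloring G k c)"

definition clique_number :: "'a hypergraph \<Rightarrow> nat" where
  "clique_number G = Max (card ` {K. K \<subseteq> verts G \<and> clique K (edges G)})"

definition perfect_graph :: "'a hypergraph \<Rightarrow> bool" where
  "perfect_graph G \<longleftrightarrow>
     (\<forall>S. S \<subseteq> verts G \<longrightarrow>
        chromatic_number (induced_subgraph G S) = clique_number (induced_subgraph G S))"

definition contextuality_scenario :: "'a hypergraph \<Rightarrow> bool" where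
  "contextuality_scenario H \<longleftrightarrow> finite (verts H) \<and> verts H \<noteq> {} \<and> \<Union> (edges H) = verts H"

text \<open>Models are extensional functions, so that equality of models is equality on the vertices.\<close>

definition probabilistic_models :: "'a hypergraph \<Rightarrow> ('a \<Rightarrow> real) set" where
  "probabilistic_models H =
     {p \<in> verts H \<rightarrow>\<^sub>E {0..1}. \<forall>e\<in>edges H. (\<Sum>v\<in>e. p v) = 1}"

definition deterministic_models :: "'a hypergraph \<Rightarrow> ('a \<Rightarrow> real) set" where
  "deterministic_models H = {p \<in> probabilistic_models H. \<forall>v\<in>verts H. p v \<in> {0, 1}}"

text \<open>Convex combinations are written out, because the type of real-valued functions is not an
  instance of \<^class>\<open>real_vector\<close>. There are none if there is no deterministic model.\<close>

definition classical_models :: "'a hypergraph \<Rightarrow> ('a \<Rightarrow> real) set" where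
  "classical_models H =
     {p. \<exists>D w. finite D \<and> D \<subseteq> deterministic_models H \<and> (\<forall>d\<in>D. 0 \<le> w d) \<and> (\<Sum>d\<in>D. w d) = 1 \<and>
           p = (\<lambda>v\<in>verts H. \<Sum>d\<in>D. w d * d v)}"

definition non_orthogonality_graph :: "'a hypergraph \<Rightarrow> 'a hypergraph" where
  "non_orthogonality_graph H =
     \<lparr>verts = verts H,
      edges = {{u, v} | u v. u \<in> verts H \<and> v \<in> verts H \<and> u \<noteq> v \<and> \<not> (\<exists>e\<in>edges H. {u, v} \<subseteq> e)}\<rparr>"

definition CE1_models :: "'a hypergraph \<Rightarrow> ('a \<Rightarrow> real) set" where
  "CE1_models H =
     {p \<in> probabilistic_models H.
        \<forall>I. I \<subseteq> verts (non_orthogonality_graph H) \<and> indep I (edges (non_orthogonality_graph H)) \<longrightarrow>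
            (\<Sum>v\<in>I. p v) \<le> 1}"

end

theory Submission
  imports Defs "HOL-Analysis.Function_Topology"
begin

text \<open>The ones of a deterministic model form a clique of \<open>NO(H)\<close> meeting every edge of \<open>H\<close>. If a
  convex combination of cliques sums to 1 on every edge, then each clique of positive weight meets
  every edge, because a clique meets an edge at most once. So it suffices to write \<open>p \<in> CE\<^sup>1(H)\<close> as
  a convex combination of cliques. If that fails, then a linear functional \<open>x\<close>, without loss of
  generality nonnegative, satisfies \<open>x(K) \<le> M < \<langle>x, p\<rangle>\<close> for all cliques \<open>K\<close>. Round \<open>N x\<close> down to
  integer weights: by the weighted form of Lovasz's replication lemma they are a sum of at most
  \<open>N M\<close> independent sets, on each of which \<open>p\<close> sums to at most 1, so that
  \<open>N \<langle>x, p\<rangle> \<le> N M + O(1)\<close>, which is false for large \<open>N\<close>.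

  For the strict inclusion take the triangle with its three sides as edges: \<open>NO(H)\<close> has no edges,
  so the constant model \<open>1/2\<close> violates the condition for the whole vertex set.\<close>

section \<open>Perfect graphs: colourings and the replication lemma\<close>

text \<open>\<open>LEAST\<close> delivers a colouring only once some colouring exists; an injective
  numbering of the finite set \<open>S\<close> is one, since no edge is a loop.\<close>

lemma perfect_graph_coloring:
  assumes "finite (verts G)" and "\<And>v. {v} \<notin> edges G" and "perfect_graph G" and "S \<subseteq> verts G"
  shows "\<exists>c. proper_coloring (induced_subgraph G S) (clique_number (induced_subgraph G S)) c"
proof -
  have fin: "finite S"
    using assms(1,4) finite_subset by blast
  then obtain f :: "'a \<Rightarrow> nat" and n where f: "f ` S = {i. i < n}" "inj_on f S"
    using finite_imp_inj_to_nat_seg by metis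
  have "proper_coloring (induced_subgraph G S) n f"
    unfolding proper_coloring_def induced_subgraph_def
    using f assms(2) by (auto dest: inj_onD)
  then have "\<exists>k c. proper_coloring (induced_subgraph G S) k c"
    by blast
  from LeastI_ex[OF this] show ?thesis
    using assms(3,4) unfolding perfect_graph_def chromatic_number_def by metis
qed

lemma card_Int_clique_indep_le:
  assumes "clique K E" and "indep I E" and "finite K"
  shows "card (K \<inter> I) \<le> 1"
proof -
  have "is_singleton (K \<inter> I) \<or> K \<inter> I = {}"
    using assms(1,2) unfolding clique_def indep_def is_singleton_def by blast
  then show ?thesis
    by (auto simp: is_singleton_def)
qed

text \<open>Double counting of incidences, with repeated list entries counted as often as they
  occur.\<close>

lemma sum_of_bool_list:
  assumes "finite K"
  shows "(\<Sum>v\<in>K. \<Sum>I\<leftarrow>Is. of_bool (v \<in> I)) = (\<Sum>I\<leftarrow>Is. card (K \<inter> I))"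
  using assms by (induction Is) (auto simp: sum.distrib Int_def)

text \<open>A single entry below 1 would leave the total short of the length. This turns tightness
  of a clique into the statement that it meets every covering set.\<close>

lemma sum_list_eq_length_imp:
  fixes f :: "'b \<Rightarrow> nat"
  assumes "(\<Sum>x\<leftarrow>xs. f x) = length xs" and "\<forall>x\<in>set xs. f x \<le> 1" and "x \<in> set xs"
  shows "f x = 1"
proof -
  have "(\<Sum>x\<leftarrow>ys. f x) \<le> length ys" if "\<forall>x\<in>set ys. f x \<le> 1" for ys
    using that by (induction ys) auto
  then show ?thesis
    using assms
  proof (induction xs)
    case (Cons y ys)
    have "(\<Sum>x\<leftarrow>ys. f x) \<le> length ys" "f y \<le> 1"
      using Cons.prems by auto
    with Cons show ?case
      by fastforce
  qed simp
qed

text \<open>The weight \<open>w v\<close> plays the part of \<open>w v\<close> pairwise adjacent copies of \<open>v\<close>, so this is Lovasz's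
  replication lemma without the replicated graph.\<close>

lemma perfect_graph_weighted_coloring:
  fixes w :: "'a \<Rightarrow> nat"
  assumes fin: "finite (verts G)" and loop: "\<And>v. {v} \<notin> edges G" and perf: "perfect_graph G"
    and "\<And>K. K \<subseteq> verts G \<Longrightarrow> clique K (edges G) \<Longrightarrow> sum w K \<le> m"
  shows "\<exists>Is. length Is = m \<and> (\<forall>I\<in>set Is. I \<subseteq> verts G \<and> indep I (edges G)) \<and>
    (\<forall>v\<in>verts G. w v = (\<Sum>I\<leftarrow>Is. of_bool (v \<in> I)))"
  using assms(4)
\<comment> \<open>Induction on the total weight. The bound \<open>m\<close> is generalised because
  the second appeal to the hypothesis uses \<open>m - 1\<close>.\<close>
proof (induction "sum w (verts G)" arbitrary: w m rule: less_induct)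
  case less
  let ?V = "verts G" and ?E = "edges G"
  have finK: "finite K" if "K \<subseteq> ?V" for K
    using that fin finite_subset by blast
  show ?case
  proof (cases "\<forall>v\<in>?V. w v \<le> 1")
    case True
    \<comment> \<open>The weight is now the indicator of \<open>S\<close>, so the assumption bounds
      the clique number of the subgraph induced on \<open>S\<close> by \<open>m\<close>, and
      perfection colours that subgraph with at most \<open>m\<close> colours.\<close>
    define S where "S = {v \<in> ?V. w v = 1}"
    have S: "S \<subseteq> ?V"
      by (auto simp: S_def)
    let ?G = "induced_subgraph G S"
    let ?Ks = "{K. K \<subseteq> verts ?G \<and> clique K (edges ?G)}"
    have le: "card K \<le> m" if "K \<in> ?Ks" for K
    proof -
      have K: "K \<subseteq> S" "clique K ?E"
        using that by (auto simp: induced_subgraph_def clique_def)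
      have "sum w K = card K"
        using K(1) sum.cong[of K K w "\<lambda>_. 1"] by (simp add: S_def subset_iff)
      then show ?thesis
        using less.prems[of K] K S by auto
    qed
    have "?Ks \<subseteq> Pow ?V"
      using S by (auto simp: induced_subgraph_def)
    then have "finite ?Ks"
      using fin by (meson finite_Pow_iff finite_subset)
    moreover have "{} \<in> ?Ks"
      by (auto simp: clique_def)
    ultimately have m: "clique_number ?G \<le> m"
      unfolding clique_number_def using le by (subst Max_le_iff) auto
    obtain c where c: "proper_coloring ?G (clique_number ?G) c"
      using perfect_graph_coloring[OF fin loop perf S] by blast
    then have c1: "c v < m" if "v \<in> S" for v
      using m that by (fastforce simp: proper_coloring_def induced_subgraph_def)
    have c2: "c u \<noteq> c v" if "u \<in> S" "v \<in> S" "{u, v} \<in> ?E" for u v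
      using c that by (auto simp: proper_coloring_def induced_subgraph_def)
    define Is where "Is = map (\<lambda>i. {v \<in> S. c v = i}) [0..<m]"
    have "w v = (\<Sum>I\<leftarrow>Is. of_bool (v \<in> I))" if "v \<in> ?V" for v
    proof -
      have "(\<Sum>I\<leftarrow>Is. of_bool (v \<in> I)) = (\<Sum>i<m. of_bool (v \<in> S \<and> i = c v))"
        by (auto simp: Is_def sum_list_sum_nth lessThan_atLeast0 intro!: sum.cong)
      also have "\<dots> = of_bool (v \<in> S)"
        using c1[of v] by (cases "v \<in> S") (auto simp: of_bool_def)
      also have "\<dots> = w v"
        using that True by (force simp: S_def le_Suc_eq)
      finally show ?thesis ..
    qed
    moreover have "I \<subseteq> ?V \<and> indep I ?E" if "I \<in> set Is" for I
      using that S by (auto simp: Is_def indep_def dest: c2)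
    ultimately show ?thesis
      by (intro exI[of _ Is]) (auto simp: Is_def)
  next
    case False
    then obtain v where v: "v \<in> ?V" "w v \<ge> 2"
      by force
    \<comment> \<open>One copy of \<open>v\<close> is deleted. As \<open>w v \<ge> 2\<close>,
      another remains, so some set \<open>A\<close> of the cover of \<open>w1\<close> contains
      \<open>v\<close>.\<close>
    define w1 where "w1 = w(v := w v - 1)"
    have w: "sum w K = sum w1 K + of_bool (v \<in> K)" if "K \<subseteq> ?V" for K
    proof -
      have "sum w K = (\<Sum>u\<in>K. w1 u + of_bool (u = v))"
        using v by (intro sum.cong) (auto simp: w1_def)
      also have "\<dots> = sum w1 K + of_bool (v \<in> K)"
        using finK[OF that] by (auto simp: sum.distrib of_bool_def)
      finally show ?thesis .
    qed
    have le1: "sum w1 K \<le> m" if "K \<subseteq> ?V" "clique K ?E" for K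
      using less.prems[OF that] w[OF that(1)] by linarith
    have "sum w1 ?V < sum w ?V"
      using w[of ?V] v by simp
    from less.hyps[OF this le1] obtain Is where Is: "length Is = m"
      "\<And>I. I \<in> set Is \<Longrightarrow> I \<subseteq> ?V \<and> indep I ?E"
      "\<And>u. u \<in> ?V \<Longrightarrow> w1 u = (\<Sum>I\<leftarrow>Is. of_bool (u \<in> I))"
      by blast
    \<comment> \<open>Guarantees that the natural-number subtraction in \<open>w2\<close> is never
      truncated.\<close>
    have pos: "w1 u \<ge> 1" if "u \<in> A" "A \<in> set Is" for u A
    proof -
      have "(1::nat) \<in> set (map (\<lambda>I. of_bool (u \<in> I)) Is)"
        using that by force
      then have "1 \<le> (\<Sum>I\<leftarrow>Is. of_bool (u \<in> I) :: nat)"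
        by (rule member_le_sum_list) simp
      then show ?thesis
        using Is(2,3) that by (metis subsetD)
    qed
    have "\<exists>A\<in>set Is. v \<in> A"
    proof (rule ccontr)
      assume "\<not> ?thesis"
      then have "(\<Sum>I\<leftarrow>Is. of_bool (v \<in> I) :: nat) = 0"
        by (auto simp: sum_list_eq_0_iff)
      with Is(3)[OF v(1)] have "w1 v = 0"
        by (simp only:)
      then show False
        using v by (simp add: w1_def)
    qed
    then obtain A where A: "A \<in> set Is" "v \<in> A"
      by blast
    \<comment> \<open>This is \<open>w\<close> minus one copy of each vertex of \<open>A\<close>:
      the copy of \<open>v\<close> is already missing from \<open>w1\<close>, hence the exception
      for \<open>v\<close>.\<close>
    define w2 where "w2 u = w1 u - of_bool (u \<in> A - {v})" for u
    have w2_le: "w2 u \<le> w1 u" for u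
      by (simp add: w2_def)
    have le2: "sum w2 K \<le> m - 1" if K: "K \<subseteq> ?V" "clique K ?E" for K
    proof (cases "sum w1 K < m")
      case True
      moreover have "sum w2 K \<le> sum w1 K"
        by (intro sum_mono w2_le)
      ultimately show ?thesis
        by simp
    next
      case False
      \<comment> \<open>A clique of weight \<open>m\<close> meets each of the \<open>m\<close> covering sets exactly once.\<close>
      then have tight: "sum w1 K = m"
        using le1[OF K] by simp
      \<comment> \<open>Containing \<open>v\<close> would give \<open>K\<close> the
        \<open>w\<close>-weight \<open>m + 1\<close>. So \<open>K\<close> meets \<open>A\<close> in
        a vertex other than \<open>v\<close>, where \<open>w2\<close> is smaller than
        \<open>w1\<close>.\<close>
      then have "v \<notin> K"
        using less.prems[OF K] w[OF K(1)] by auto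
      have "(\<Sum>I\<leftarrow>Is. card (K \<inter> I)) = (\<Sum>u\<in>K. \<Sum>I\<leftarrow>Is. of_bool (u \<in> I))"
        using sum_of_bool_list[OF finK[OF K(1)], of Is] by simp
      also have "\<dots> = sum w1 K"
        using Is(3) K(1) by (intro sum.cong) auto
      finally have "(\<Sum>I\<leftarrow>Is. card (K \<inter> I)) = length Is"
        using tight Is(1) by simp
      then have "card (K \<inter> A) = 1"
        using sum_list_eq_length_imp[of "\<lambda>I. card (K \<inter> I)" Is A] A
          card_Int_clique_indep_le[OF K(2) _ finK[OF K(1)]] Is(2) by auto
      then obtain u where u: "u \<in> K" "u \<in> A"
        by (metis Int_iff card_1_singletonE insertI1)
      have "w2 u < w1 u"
        using pos[OF u(2) A(1)] u \<open>v \<notin> K\<close> by (auto simp: w2_def)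
      then have "sum w2 K < sum w1 K"
        using finK[OF K(1)] u w2_le by (intro sum_strict_mono_ex1) auto
      then show ?thesis
        using tight by simp
    qed
    have "sum w2 ?V \<le> sum w1 ?V"
      by (intro sum_mono w2_le)
    then have "sum w2 ?V < sum w ?V"
      using \<open>sum w1 ?V < sum w ?V\<close> by simp
    from less.hyps[OF this le2] obtain Js where Js: "length Js = m - 1"
      "\<And>I. I \<in> set Js \<Longrightarrow> I \<subseteq> ?V \<and> indep I ?E"
      "\<And>u. u \<in> ?V \<Longrightarrow> w2 u = (\<Sum>I\<leftarrow>Js. of_bool (u \<in> I))"
      by blast
    \<comment> \<open>Makes \<open>m - 1\<close> a true predecessor, so that \<open>A # Js\<close>
      has length \<open>m\<close>.\<close>
    have "m > 0"
      using Is(1) A by (cases Is) auto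
    moreover have "w u = (\<Sum>I\<leftarrow>A # Js. of_bool (u \<in> I))" if "u \<in> ?V" for u
    proof -
      have "w u = of_bool (u \<in> A) + w2 u"
        using pos[OF _ A(1), of u] v A by (auto simp: w1_def w2_def of_bool_def)
      then show ?thesis
        using Js(3)[OF that] by simp
    qed
    ultimately show ?thesis
      using Js(1,2) Is(2) A by (intro exI[of _ "A # Js"]) auto
  qed
qed

section \<open>Separation of a point from a finitely generated convex hull\<close>

text \<open>By Tychonoff a product of compact sets is compact, and the sum condition is closed.
  Pinning the coordinates outside \<open>I\<close> to 0 keeps the product compact in the full
  function space.\<close>

lemma compact_simplex:
  fixes I :: "'i set"
  assumes "finite I"
  shows "compact {l :: 'i \<Rightarrow> real. (\<forall>i. l i \<in> (if i \<in> I then {0..1} else {0})) \<and> sum l I = 1}"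
proof -
  let ?B = "\<lambda>i. if i \<in> I then {0..1} else {0 :: real}"
  have "compactin (product_topology (\<lambda>i :: 'i. euclidean) UNIV) (PiE UNIV ?B)"
    by (subst compactin_PiE) auto
  then have "compact (PiE UNIV ?B)"
    by (simp add: euclidean_product_topology)
  moreover have "closed {l :: 'i \<Rightarrow> real. sum l I = 1}"
    by (intro closed_Collect_eq continuous_intros continuous_on_product_coordinates)
  ultimately have "compact (PiE UNIV ?B \<inter> {l. sum l I = 1})"
    by (rule compact_Int_closed)
  moreover have "PiE UNIV ?B \<inter> {l. sum l I = 1} = {l. (\<forall>i. l i \<in> ?B i) \<and> sum l I = 1}"
    by (auto simp: PiE_iff simp del: if_image_distrib split: if_splits)
  ultimately show ?thesis
    by simp
qed

text \<open>The separating functional is the difference between the point \<open>p\<close> and the nearest point of the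
  convex hull of the \<open>a i\<close>. The types are arbitrary, so the library's separation theorems for
  Euclidean spaces do not apply.\<close>

lemma convex_combination_or_separated:
  fixes a :: "'i \<Rightarrow> 'v \<Rightarrow> real" and p :: "'v \<Rightarrow> real"
  assumes fin: "finite I" "finite V" and ne: "I \<noteq> {}"
  shows "(\<exists>l. (\<forall>i\<in>I. 0 \<le> l i) \<and> sum l I = 1 \<and> (\<forall>v\<in>V. p v = (\<Sum>i\<in>I. l i * a i v))) \<or>
    (\<exists>x M. (\<forall>i\<in>I. (\<Sum>v\<in>V. x v * a i v) \<le> M) \<and> M < (\<Sum>v\<in>V. x v * p v))"
proof -
  define D where "D = {l :: 'i \<Rightarrow> real. (\<forall>i. l i \<in> (if i \<in> I then {0..1} else {0})) \<and> sum l I = 1}"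
  define q where "q l v = (\<Sum>i\<in>I. l i * a i v)" for l v
  define f where "f l = (\<Sum>v\<in>V. (p v - q l v)\<^sup>2)" for l
  obtain i0 where i0: "i0 \<in> I"
    using ne by blast
  have "(\<lambda>i. of_bool (i = i0)) \<in> D"
    using i0 fin by (auto simp: D_def of_bool_def)
  then have "D \<noteq> {}"
    by blast
  moreover have "continuous_on D f"
    unfolding f_def q_def
    by (intro continuous_intros continuous_on_product_coordinates[THEN continuous_on_subset]) auto
  ultimately obtain l where l: "l \<in> D" and min: "\<And>k. k \<in> D \<Longrightarrow> f l \<le> f k"
    using continuous_attains_inf[OF compact_simplex[OF fin(1)], folded D_def] by blast
  define x where "x v = p v - q l v" for v
  have l01: "0 \<le> l i" "l i \<le> 1" if "i \<in> I" for i
    using l that by (auto simp: D_def dest: spec[of _ i])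
  have l0: "l i = 0" if "i \<notin> I" for i
    using l that by (auto simp: D_def dest: spec[of _ i])
  have l1: "sum l I = 1"
    using l by (simp add: D_def)
  show ?thesis
  proof (cases "\<forall>v\<in>V. x v = 0")
    case True
    then have "\<forall>v\<in>V. p v = (\<Sum>i\<in>I. l i * a i v)"
      by (simp add: x_def q_def)
    then show ?thesis
      using l01(1) l1 by blast
  next
    case False
    have "(\<Sum>v\<in>V. x v * a i v) \<le> (\<Sum>v\<in>V. x v * q l v)" if i: "i \<in> I" for i
    proof -
      define b where "b v = a i v - q l v" for v
      let ?B = "\<Sum>v\<in>V. x v * b v" and ?C = "\<Sum>v\<in>V. (b v)\<^sup>2"
      \<comment> \<open>Minimality of \<open>l\<close> is tested at the point with parameter
        \<open>t\<close> on the segment from \<open>q l\<close> to \<open>a i\<close>, where the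
        squared distance changes by \<open>t * (t * ?C - 2 * ?B)\<close>.\<close>
      have ineq: "2 * ?B \<le> t * ?C" if t: "0 < t" "t \<le> 1" for t
      proof -
        define k where "k j = (1 - t) * l j + t * of_bool (j = i)" for j
        have "sum k I = (1 - t) * sum l I + t * (\<Sum>j\<in>I. of_bool (j = i))"
          by (simp add: k_def sum.distrib sum_distrib_left)
        then have k1: "sum k I = 1"
          using l1 i fin by (simp add: of_bool_def)
        have k2: "0 \<le> k j" if "j \<in> I" for j
          using l01[OF that] t by (simp add: k_def)
        have "k j \<le> 1" if "j \<in> I" for j
          using member_le_sum[of j I k] k1 k2 fin that by auto
        then have "k \<in> D"
          using k1 k2 l0 i by (auto simp: D_def k_def)
        from min[OF this] have "f l \<le> f k" .
        moreover have "p v - q k v = x v - t * b v" for v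
        proof -
          have "q k v = (\<Sum>j\<in>I. (1 - t) * (l j * a j v) + t * (of_bool (j = i) * a j v))"
            by (simp add: q_def k_def algebra_simps)
          also have "\<dots> = (1 - t) * q l v + t * (\<Sum>j\<in>I. of_bool (j = i) * a j v)"
            by (simp add: sum.distrib sum_distrib_left q_def)
          also have "(\<Sum>j\<in>I. of_bool (j = i) * a j v) = a i v"
            using i fin by (simp add: of_bool_def if_distrib[of "\<lambda>c. c * _"] cong: if_cong)
          finally show ?thesis
            by (simp add: x_def b_def algebra_simps)
        qed
        ultimately have "(\<Sum>v\<in>V. (x v)\<^sup>2) \<le> (\<Sum>v\<in>V. (x v - t * b v)\<^sup>2)"
          by (simp add: f_def x_def)
        also have "\<dots> = (\<Sum>v\<in>V. (x v)\<^sup>2) - 2 * t * ?B + t\<^sup>2 * ?C"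
          by (simp add: power2_diff power_mult_distrib sum.distrib sum_subtractf sum_distrib_left
              algebra_simps)
        finally have "t * (2 * ?B) \<le> t * (t * ?C)"
          by (simp add: power2_eq_square algebra_simps)
        then show ?thesis
          using t by simp
      qed
      have C: "?C \<ge> 0"
        by (intro sum_nonneg) auto
      have "?B \<le> 0"
      proof (rule ccontr)
        assume B: "\<not> ?B \<le> 0"
        \<comment> \<open>The quotient gives \<open>t * ?C \<le> ?B\<close>, against
          \<open>2 * ?B \<le> t * ?C\<close> with \<open>?B\<close> positive. Adding 1 covers
          \<open>?C = 0\<close>, and the minimum keeps the point on the segment.\<close>
        define t where "t = min 1 (?B / (?C + 1))"
        have t: "0 < t" "t \<le> 1"
          using B C by (auto simp: t_def)
        have "t * ?C \<le> ?B / (?C + 1) * ?C"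
          using C by (intro mult_right_mono) (auto simp: t_def)
        also have "\<dots> \<le> ?B"
          using B C by (simp add: field_simps)
        finally show False
          using ineq[OF t] B by simp
      qed
      then show ?thesis
        by (simp add: b_def algebra_simps sum_subtractf)
    qed
    \<comment> \<open>With \<open>M\<close> the value at the nearest point, the gap is the squared
      length of \<open>x\<close>.\<close>
    moreover have "(\<Sum>v\<in>V. x v * q l v) < (\<Sum>v\<in>V. x v * p v)"
    proof -
      have "(\<Sum>v\<in>V. (x v)\<^sup>2) > 0"
        using False fin(2) sum_nonneg_eq_0_iff[of V "\<lambda>v. (x v)\<^sup>2"]
        by (auto simp: less_le intro!: sum_nonneg)
      moreover have "(\<Sum>v\<in>V. x v * p v) - (\<Sum>v\<in>V. x v * q l v) = (\<Sum>v\<in>V. (x v)\<^sup>2)"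
        unfolding sum_subtractf[symmetric]
        by (intro sum.cong) (auto simp: x_def power2_eq_square algebra_simps)
      ultimately show ?thesis
        by simp
    qed
    ultimately show ?thesis
      by blast
  qed
qed

section \<open>The clique polytope of a perfect graph\<close>

lemma sum_cover_mult:
  fixes p :: "'a \<Rightarrow> real"
  assumes "finite V"
  shows "(\<Sum>v\<in>V. real (\<Sum>I\<leftarrow>Is. of_bool (v \<in> I)) * p v) = (\<Sum>I\<leftarrow>Is. sum p (V \<inter> I))"
  using assms
  by (induction Is) (auto simp: algebra_simps sum.distrib sum.inter_restrict intro!: sum.cong)

text \<open>Read in the complementary graph, this describes the stable set polytope of a perfect
  graph by its clique inequalities.\<close>

lemma perfect_graph_clique_combination:
  fixes p :: "'a \<Rightarrow> real"
  assumes fin: "finite (verts G)" and loop: "\<And>v. {v} \<notin> edges G" and perf: "perfect_graph G"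
    and nonneg: "\<And>v. v \<in> verts G \<Longrightarrow> 0 \<le> p v"
    and le1: "\<And>I. I \<subseteq> verts G \<Longrightarrow> indep I (edges G) \<Longrightarrow> sum p I \<le> 1"
  defines "Ks \<equiv> {K. K \<subseteq> verts G \<and> clique K (edges G)}"
  shows "\<exists>l. (\<forall>K\<in>Ks. 0 \<le> l K) \<and> sum l Ks = 1 \<and>
    (\<forall>v\<in>verts G. p v = (\<Sum>K\<in>Ks. l K * of_bool (v \<in> K)))"
proof (rule ccontr)
  assume neg: "\<not> ?thesis"
  let ?V = "verts G"
  have empty: "{} \<in> Ks" and "finite Ks"
    using fin by (simp_all add: Ks_def)
  have "\<exists>x M. (\<forall>K\<in>Ks. (\<Sum>v\<in>?V. x v * of_bool (v \<in> K)) \<le> M) \<and> M < (\<Sum>v\<in>?V. x v * p v)"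
    by (rule disjE[OF convex_combination_or_separated[OF \<open>finite Ks\<close> fin,
          where a = "\<lambda>K v. of_bool (v \<in> K)" and p = p]])
      (use empty in blast, erule notE[OF neg], assumption)
  then obtain x M where
    x: "\<And>K. K \<in> Ks \<Longrightarrow> (\<Sum>v\<in>?V. x v * of_bool (v \<in> K)) \<le> M" and
    M: "M < (\<Sum>v\<in>?V. x v * p v)"
    by blast
  define y where "y v = max 0 (x v)" for v
  have y0: "y v \<ge> 0" for v
    by (simp add: y_def)
  \<comment> \<open>The empty clique has value 0. Nonnegativity of \<open>M\<close> makes
    \<open>real m \<le> real N * M\<close> true despite the cut-off by \<open>nat\<close>.\<close>
  have M0: "M \<ge> 0"
    using x[OF empty] by simp
  \<comment> \<open>Subsets of cliques are cliques, so the functional may be replaced by its positive part.\<close>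
  have yK: "sum y K \<le> M" if "K \<subseteq> ?V" "clique K (edges G)" for K
  proof -
    have "{v \<in> K. x v > 0} \<in> Ks"
      using that by (auto simp: Ks_def clique_def)
    from x[OF this] have "(\<Sum>v\<in>?V. x v * of_bool (v \<in> K \<and> x v > 0)) \<le> M"
      by simp
    also have "(\<Sum>v\<in>?V. x v * of_bool (v \<in> K \<and> x v > 0)) = (\<Sum>v\<in>K. y v)"
      using that fin by (intro sum.mono_neutral_cong_right) (auto simp: y_def max_def)
    finally show ?thesis .
  qed
  have "(\<Sum>v\<in>?V. x v * p v) \<le> (\<Sum>v\<in>?V. y v * p v)"
    by (intro sum_mono mult_right_mono nonneg) (auto simp: y_def)
  with M have gap: "0 < (\<Sum>v\<in>?V. y v * p v) - M"
    by simp
  \<comment> \<open>Rounding down loses less than 1 per vertex, hence at most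
    \<open>sum p ?V\<close> after weighting by \<open>p\<close>; the scaled gap must exceed this
    loss.\<close>
  obtain N :: nat where N: "sum p ?V < real N * ((\<Sum>v\<in>?V. y v * p v) - M)"
    using reals_Archimedean3[OF gap] by blast
  define w where "w v = nat \<lfloor>real N * y v\<rfloor>" for v
  define m where "m = nat \<lfloor>real N * M\<rfloor>"
  have w: "real (w v) \<le> real N * y v" "real N * y v - 1 \<le> real (w v)" for v
    using y0[of v] by (auto simp: w_def)
  have "sum w K \<le> m" if "K \<subseteq> ?V" "clique K (edges G)" for K
  proof -
    have "real (sum w K) \<le> (\<Sum>v\<in>K. real N * y v)"
      using w by (auto intro: sum_mono)
    also have "\<dots> \<le> real N * M"
      using yK[OF that] by (simp add: mult_left_mono flip: sum_distrib_left)
    finally show ?thesis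
      by (simp add: m_def le_nat_floor)
  qed
  then obtain Is where Is: "length Is = m" "\<And>I. I \<in> set Is \<Longrightarrow> I \<subseteq> ?V \<and> indep I (edges G)"
    "\<And>v. v \<in> ?V \<Longrightarrow> w v = (\<Sum>I\<leftarrow>Is. of_bool (v \<in> I))"
    using perfect_graph_weighted_coloring[OF fin loop perf, of w m] by blast
  have "(\<Sum>v\<in>?V. real (w v) * p v) = (\<Sum>v\<in>?V. real (\<Sum>I\<leftarrow>Is. of_bool (v \<in> I)) * p v)"
    using Is(3) by (intro sum.cong) auto
  also have "\<dots> = (\<Sum>I\<leftarrow>Is. sum p (?V \<inter> I))"
    by (rule sum_cover_mult[OF fin])
  also have "\<dots> \<le> (\<Sum>I\<leftarrow>Is. 1)"
    using Is(2) le1 by (intro sum_list_mono) (simp add: Int_absorb1)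
  also have "\<dots> = real m"
    using Is(1) by (simp add: sum_list_triv)
  also have "\<dots> \<le> real N * M"
    using M0 by (simp add: m_def)
  finally have "(\<Sum>v\<in>?V. real (w v) * p v) \<le> real N * M" .
  moreover have "(\<Sum>v\<in>?V. (real N * y v - 1) * p v) \<le> (\<Sum>v\<in>?V. real (w v) * p v)"
    by (intro sum_mono mult_right_mono nonneg w)
  moreover have "(\<Sum>v\<in>?V. (real N * y v - 1) * p v) = real N * (\<Sum>v\<in>?V. y v * p v) - sum p ?V"
    by (simp add: algebra_simps sum_subtractf sum_distrib_left)
  ultimately show False
    using N by (simp add: algebra_simps)
qed

section \<open>Models and the non-orthogonality graph\<close>

lemma verts_non_orthogonality_graph [simp]: "verts (non_orthogonality_graph H) = verts H"
  by (simp add: non_orthogonality_graph_def)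

lemma singleton_notin_edges_non_orthogonality_graph: "{v} \<notin> edges (non_orthogonality_graph H)"
  by (auto simp: non_orthogonality_graph_def doubleton_eq_iff)

lemma edge_non_orthogonality_graph_iff:
  "{u, v} \<in> edges (non_orthogonality_graph H) \<longleftrightarrow>
    u \<in> verts H \<and> v \<in> verts H \<and> u \<noteq> v \<and> \<not> (\<exists>e\<in>edges H. u \<in> e \<and> v \<in> e)"
  by (auto simp: non_orthogonality_graph_def doubleton_eq_iff)

lemma indep_edge:
  assumes "e \<in> edges H"
  shows "indep e (edges (non_orthogonality_graph H))"
  using assms by (auto simp: indep_def edge_non_orthogonality_graph_iff)

text \<open>Two ones in \<open>I\<close> would be non-adjacent and so share an edge of
  \<open>H\<close>, whose sum would then be at least 2.\<close>

lemma deterministic_sum_indep_le: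
  assumes H: "contextuality_scenario H" and d: "d \<in> deterministic_models H"
    and I: "I \<subseteq> verts H" "indep I (edges (non_orthogonality_graph H))"
  shows "sum d I \<le> 1"
proof -
  have fin: "finite (verts H)" and sub: "\<And>e. e \<in> edges H \<Longrightarrow> e \<subseteq> verts H"
    using H by (auto simp: contextuality_scenario_def)
  have d01: "\<And>v. v \<in> verts H \<Longrightarrow> d v = 0 \<or> d v = 1"
    and d1: "\<And>e. e \<in> edges H \<Longrightarrow> sum d e = 1"
    using d by (auto simp: deterministic_models_def probabilistic_models_def)
  have uniq: "u = v" if uv: "u \<in> I" "v \<in> I" "d u = 1" "d v = 1" for u v
  proof (rule ccontr)
    assume "u \<noteq> v"
    then have "{u, v} \<notin> edges (non_orthogonality_graph H)"
      using I(2) uv by (simp add: indep_def)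
    then obtain e where e: "e \<in> edges H" "u \<in> e" "v \<in> e"
      using I(1) uv \<open>u \<noteq> v\<close> unfolding edge_non_orthogonality_graph_iff by blast
    have "sum d {u, v} \<le> sum d e"
    proof (rule sum_mono2)
      show "0 \<le> d x" if "x \<in> e - {u, v}" for x
        using d01[OF subsetD[OF sub[OF e(1)], of x]] that by auto
    qed (use e finite_subset[OF sub[OF e(1)] fin] in simp_all)
    then show False
      using uv \<open>u \<noteq> v\<close> d1[OF e(1)] by simp
  qed
  show ?thesis
  proof (cases "\<exists>u\<in>I. d u = 1")
    case True
    then obtain u where u: "u \<in> I" "d u = 1"
      by blast
    have "sum d I = sum d {u}"
    proof (rule sum.mono_neutral_right)
      show "\<forall>x\<in>I - {u}. d x = 0"
        using u uniq d01 I(1) by blast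
    qed (use u finite_subset[OF I(1) fin] in simp_all)
    then show ?thesis
      using u by simp
  next
    case False
    then have "sum d I = 0"
      using d01 I(1) by (intro sum.neutral) auto
    then show ?thesis
      by simp
  qed
qed

text \<open>The conditions are linear in the model and hold for deterministic ones, so they pass to
  convex combinations.\<close>

lemma classical_models_subset_CE1_models:
  assumes H: "contextuality_scenario H"
  shows "classical_models H \<subseteq> CE1_models H"
proof
  fix p
  assume "p \<in> classical_models H"
  then obtain D w where D: "finite D" "D \<subseteq> deterministic_models H"
    and w: "\<And>d. d \<in> D \<Longrightarrow> 0 \<le> w d" "(\<Sum>d\<in>D. w d) = 1"
    and p: "p = (\<lambda>v\<in>verts H. \<Sum>d\<in>D. w d * d v)"
    by (auto simp: classical_models_def)
  have sum_p: "sum p A = (\<Sum>d\<in>D. w d * sum d A)" if "A \<subseteq> verts H" for A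
  proof -
    have "sum p A = (\<Sum>v\<in>A. \<Sum>d\<in>D. w d * d v)"
      using that by (intro sum.cong) (auto simp: p)
    also have "\<dots> = (\<Sum>d\<in>D. \<Sum>v\<in>A. w d * d v)"
      by (rule sum.swap)
    finally show ?thesis
      by (simp add: sum_distrib_left)
  qed
  \<comment> \<open>Serves twice: for singletons, giving \<open>p v \<le> 1\<close>, and for
    independent sets.\<close>
  have mono: "sum p A \<le> 1" if "A \<subseteq> verts H" "\<And>d. d \<in> D \<Longrightarrow> sum d A \<le> 1" for A
  proof -
    have "sum p A \<le> (\<Sum>d\<in>D. w d * 1)"
      unfolding sum_p[OF that(1)] by (intro sum_mono mult_left_mono that w)
    then show ?thesis
      using w by simp
  qed
  have dv: "0 \<le> d v" "d v \<le> 1" if "d \<in> D" "v \<in> verts H" for d v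
    using that D by (auto simp: deterministic_models_def probabilistic_models_def PiE_iff subset_iff)
  have "p v \<in> {0..1}" if v: "v \<in> verts H" for v
  proof -
    have "0 \<le> p v"
      using v w dv by (auto simp: p intro!: sum_nonneg)
    then show ?thesis
      using mono[of "{v}"] dv v by simp
  qed
  moreover have "sum p e = 1" if e: "e \<in> edges H" for e
  proof -
    have "e \<subseteq> verts H"
      using H e by (auto simp: contextuality_scenario_def)
    then have "sum p e = (\<Sum>d\<in>D. w d * sum d e)"
      by (rule sum_p)
    also have "\<dots> = (\<Sum>d\<in>D. w d * 1)"
      using D e
      by (intro sum.cong) (auto simp: deterministic_models_def probabilistic_models_def)
    finally show ?thesis
      using w by simp
  qed
  ultimately have "p \<in> probabilistic_models H"
    by (auto simp: probabilistic_models_def p)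
  then show "p \<in> CE1_models H"
    using mono deterministic_sum_indep_le[OF H] D by (auto simp: CE1_models_def)
qed

lemma CE1_models_subset_classical_models:
  assumes H: "contextuality_scenario H" and perf: "perfect_graph (non_orthogonality_graph H)"
  shows "CE1_models H \<subseteq> classical_models H"
proof
  fix p
  assume "p \<in> CE1_models H"
  then have p: "p \<in> verts H \<rightarrow>\<^sub>E {0..1}" "\<And>e. e \<in> edges H \<Longrightarrow> sum p e = 1"
    and le1: "\<And>I. I \<subseteq> verts H \<Longrightarrow> indep I (edges (non_orthogonality_graph H)) \<Longrightarrow> sum p I \<le> 1"
    by (auto simp: CE1_models_def probabilistic_models_def)
  let ?E = "edges (non_orthogonality_graph H)"
  define Ks where "Ks = {K. K \<subseteq> verts H \<and> clique K ?E}"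
  have fin: "finite (verts H)" and sub: "\<And>e. e \<in> edges H \<Longrightarrow> e \<subseteq> verts H"
    using H by (auto simp: contextuality_scenario_def)
  have finK: "finite Ks"
    using fin by (simp add: Ks_def)
  have "\<And>v. v \<in> verts H \<Longrightarrow> 0 \<le> p v"
    using p(1) by (auto simp: PiE_iff)
  from perfect_graph_clique_combination[of "non_orthogonality_graph H" p,
      unfolded verts_non_orthogonality_graph, folded Ks_def,
      OF fin singleton_notin_edges_non_orthogonality_graph perf this le1]
  obtain l where l: "\<And>K. K \<in> Ks \<Longrightarrow> 0 \<le> l K" "sum l Ks = 1"
    and pl: "\<And>v. v \<in> verts H \<Longrightarrow> p v = (\<Sum>K\<in>Ks. l K * of_bool (v \<in> K))"
    by blast
  define d where "d K = (\<lambda>v\<in>verts H. of_bool (v \<in> K) :: real)" for K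
  \<comment> \<open>Only cliques of nonzero weight are forced to meet every edge of
    \<open>H\<close>, so the others are dropped.\<close>
  define L where "L = {K \<in> Ks. l K \<noteq> 0}"
  have L: "L \<subseteq> Ks" "finite L"
    using finK by (auto simp: L_def)
  \<comment> \<open>\<open>classical_models\<close> attaches weights to models rather than to
    cliques; injectivity lets \<open>l\<close> be carried over without merging terms.\<close>
  have inj: "inj_on d L"
  proof (rule inj_onI)
    fix K K' assume K: "K \<in> L" "K' \<in> L" and eq: "d K = d K'"
    have "v \<in> K \<longleftrightarrow> v \<in> K'" if "v \<in> verts H" for v
      using fun_cong[OF eq, of v] that by (simp add: d_def of_bool_def split: if_splits)
    then show "K = K'"
      using K by (auto simp: L_def Ks_def)
  qed
  have det: "d K \<in> deterministic_models H" if K: "K \<in> L" for K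
  proof -
    have "sum (d K) e = 1" if e: "e \<in> edges H" for e
    proof -
      have sum_d: "sum (d J) e = card (J \<inter> e)" for J
      proof -
        have "sum (d J) e = (\<Sum>v\<in>e. of_bool (v \<in> J))"
          using sub[OF e] by (intro sum.cong) (auto simp: d_def)
        then show ?thesis
          using finite_subset[OF sub[OF e] fin] by (simp add: Int_commute)
      qed
      have le: "sum (d J) e \<le> 1" if "J \<in> Ks" for J
        using card_Int_clique_indep_le[of J ?E e] indep_edge[OF e] that fin
        by (auto simp: sum_d Ks_def finite_subset)
      \<comment> \<open>The slacks \<open>1 - sum (d J) e\<close> are nonnegative and their weighted
        total is \<open>1 - sum p e = 0\<close>, so each weighted slack vanishes.\<close>
      have "(\<Sum>J\<in>Ks. l J * (1 - sum (d J) e)) = 1 - (\<Sum>J\<in>Ks. l J * sum (d J) e)"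
        using l(2) by (simp add: algebra_simps sum_subtractf)
      also have "(\<Sum>J\<in>Ks. l J * sum (d J) e) = (\<Sum>v\<in>e. \<Sum>J\<in>Ks. l J * d J v)"
        unfolding sum_distrib_left by (rule sum.swap)
      also have "\<dots> = sum p e"
        using sub[OF e] by (intro sum.cong) (auto simp: pl d_def)
      finally have "(\<Sum>J\<in>Ks. l J * (1 - sum (d J) e)) = 0"
        using p(2)[OF e] by simp
      then have "l K * (1 - sum (d K) e) = 0"
        using finK l(1) le K L(1) by (subst (asm) sum_nonneg_eq_0_iff) auto
      then show ?thesis
        using K by (simp add: L_def)
    qed
    then show ?thesis
      by (auto simp: deterministic_models_def probabilistic_models_def d_def)
  qed
  define w where "w = l \<circ> the_inv_into L d"
  have wd: "w (d K) = l K" if "K \<in> L" for K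
    using that inj by (simp add: w_def the_inv_into_f_f)
  have sum_L: "(\<Sum>K\<in>L. l K * g K) = (\<Sum>K\<in>Ks. l K * g K)" for g :: "_ \<Rightarrow> real"
    using finK L by (intro sum.mono_neutral_left) (auto simp: L_def)
  have "(\<Sum>c\<in>d ` L. w c) = 1"
    using sum_L[of "\<lambda>_. 1"] l(2) inj by (simp add: sum.reindex wd)
  moreover have "p = (\<lambda>v\<in>verts H. \<Sum>c\<in>d ` L. w c * c v)"
  proof (rule extensionalityI[of _ "verts H"])
    show "p \<in> extensional (verts H)"
      using p(1) by (simp add: PiE_iff)
    fix v assume v: "v \<in> verts H"
    have "(\<Sum>c\<in>d ` L. w c * c v) = (\<Sum>K\<in>L. l K * of_bool (v \<in> K))"
      using inj by (simp add: sum.reindex wd) (simp add: d_def v)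
    then show "p v = (\<lambda>v\<in>verts H. \<Sum>c\<in>d ` L. w c * c v) v"
      using v sum_L by (simp add: pl)
  qed simp
  ultimately show "p \<in> classical_models H"
    unfolding classical_models_def using det L l(1) wd
    by (intro CollectI exI[of _ "d ` L"] exI[of _ w]) auto
qed

lemma classical_models_eq_CE1_models:
  assumes "contextuality_scenario H" and "perfect_graph (non_orthogonality_graph H)"
  shows "classical_models H = CE1_models H"
  using classical_models_subset_CE1_models CE1_models_subset_classical_models assms by blast

section \<open>The scenario with strict inclusion\<close>

lemma perfect_graph_edgeless:
  assumes "finite (verts G)" and "edges G = {}"
  shows "perfect_graph G"
  unfolding perfect_graph_def
proof (intro allI impI)
  fix S assume S: "S \<subseteq> verts G"
  let ?G = "induced_subgraph G S"
  have fin: "finite S"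
    using S assms(1) finite_subset by blast
  have clique: "clique K (edges ?G) \<longleftrightarrow> K = {} \<or> (\<exists>v. K = {v})" for K
  proof -
    have "clique K (edges ?G) \<longleftrightarrow> (\<forall>v\<in>K. \<forall>w\<in>K. v = w)"
      using assms(2) by (simp add: induced_subgraph_def clique_def)
    then show ?thesis
      by (metis all_not_in_conv insertE insertI1 singletonD subsetI subset_singletonD)
  qed
  have coloring: "proper_coloring ?G k c \<longleftrightarrow> c ` S \<subseteq> {..<k}" for k c
    using assms(2) by (auto simp: induced_subgraph_def proper_coloring_def)
  show "chromatic_number ?G = clique_number ?G"
  \<comment> \<open>Both numbers are 0 for the empty induced subgraph and 1 for every other
    one.\<close>
  proof (cases "S = {}")
    case True
    have "{K. K \<subseteq> verts ?G \<and> clique K (edges ?G)} = {{}}"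
      using True by (auto simp: induced_subgraph_def)
    then show ?thesis
      unfolding clique_number_def chromatic_number_def coloring using True by simp
  next
    case False
    have "chromatic_number ?G = 1"
      unfolding chromatic_number_def coloring
    proof (rule Least_equality)
      show "\<exists>c. c ` S \<subseteq> {..<1::nat}"
        by (intro exI[of _ "\<lambda>_. 0"]) auto
      show "1 \<le> k" if "\<exists>c. c ` S \<subseteq> {..<k}" for k :: nat
      proof (cases k)
        case 0
        then show ?thesis
          using that False by auto
      qed simp
    qed
    moreover have "{K. K \<subseteq> verts ?G \<and> clique K (edges ?G)} = insert {} ((\<lambda>v. {v}) ` S)"
      unfolding clique by (auto simp: induced_subgraph_def)
    then have "card ` {K. K \<subseteq> verts ?G \<and> clique K (edges ?G)} = {0, 1}"
      using False by (simp add: image_image image_constant_conv)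
    ultimately show ?thesis
      by (simp add: clique_number_def)
  qed
qed

text \<open>Specker's triangle. Its edge equations force the value 1/2 everywhere, so there is no
  deterministic model and the equality of classical and CE1 models is one between empty
  sets.\<close>

definition triangle_scenario :: "nat hypergraph" where
  "triangle_scenario = \<lparr>verts = {0, 1, 2}, edges = {{0, 1}, {1, 2}, {0, 2}}\<rparr>"

lemma contextuality_scenario_triangle_scenario: "contextuality_scenario triangle_scenario"
  by (auto simp: contextuality_scenario_def triangle_scenario_def)

lemma edges_non_orthogonality_graph_triangle_scenario:
  "edges (non_orthogonality_graph triangle_scenario) = {}"
  by (auto simp: non_orthogonality_graph_def triangle_scenario_def)

lemma CE1_models_triangle_scenario_psubset:
  "CE1_models triangle_scenario \<subset> probabilistic_models triangle_scenario"
proof -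
  let ?p = "\<lambda>v\<in>verts triangle_scenario. 1 / 2 :: real"
  have "?p \<in> probabilistic_models triangle_scenario"
    by (auto simp: probabilistic_models_def triangle_scenario_def)
  moreover have "?p \<notin> CE1_models triangle_scenario"
  proof
    assume "?p \<in> CE1_models triangle_scenario"
    moreover have "indep (verts triangle_scenario)
        (edges (non_orthogonality_graph triangle_scenario))"
      by (simp add: edges_non_orthogonality_graph_triangle_scenario indep_def)
    ultimately have "sum ?p (verts triangle_scenario) \<le> 1"
      unfolding CE1_models_def verts_non_orthogonality_graph by blast
    then show False
      by (simp add: triangle_scenario_def)
  qed
  moreover have "CE1_models triangle_scenario \<subseteq> probabilistic_models triangle_scenario"
    by (auto simp: CE1_models_def)
  ultimately show ?thesis
    by blast
qed

theorem theorem7p7p1: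
  shows "(\<forall>H :: 'a hypergraph.
            contextuality_scenario H \<and> perfect_graph (non_orthogonality_graph H) \<longrightarrow>
              classical_models H = CE1_models H) \<and>
         (\<exists>H :: nat hypergraph.
            contextuality_scenario H \<and> perfect_graph (non_orthogonality_graph H) \<and>
              classical_models H = CE1_models H \<and> CE1_models H \<subset> probabilistic_models H)"
proof -
  have "finite (verts triangle_scenario)"
    by (simp add: triangle_scenario_def)
  then have "perfect_graph (non_orthogonality_graph triangle_scenario)"
    by (intro perfect_graph_edgeless)
      (simp_all add: edges_non_orthogonality_graph_triangle_scenario)
  with contextuality_scenario_triangle_scenario CE1_models_triangle_scenario_psubset
  show ?thesis
    by (auto simp: classical_models_eq_CE1_models intro!: exI[of _ triangle_scenario])
qed

end
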